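(* Consider the water-at-rest preserving finite difference method for the shallow water system described in the context, with WENO reconstructions and the global Lax–Friedrichs flux-splitting. Then the first component of $\widehat{\mathcal F}_{i,i+1/2}$ is $$\widehat f_{i,i+1/2;1}=\frac12\left(\hat f^-_{i+1/2}+\hat f^+_{i+1/2}\right),$$ where $$\hat f^-_{i+1/2}=\mathcal R^R_1\left(q_{i-k+1}-\alpha\eta_{i-k+1},\dots,q_{i+k+1}-\alpha\eta_{i+k+1}\right),$$ $$\hat f^+_{i+1/2}=\mathcal R^L_1\left(q_{i-k}+\alpha\eta_{i-k},\dots,q_{i+k}+\alpha\eta_{i+k}\right),$$ and $\mathcal R^L_1,\mathcal R^R_1$ denote the first components of the left- and right-biased reconstructions (which act component by component). Hence the numerical mass fluxes do not depend on the selected stationary solution $U_i^*$, and thus mass is conserved (the method is conservative for the mass equation).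
   Context: Shallow water system: $U=[h,q]^T$ with $h>0$, $F(U)=[q,\ q^2/h+\tfrac g2h^2]^T$, $S(U)=[0,\ gh]^T$, $U_t+F(U)_x=S(U)H_x$, where $g>0$ and $H$ is a given depth function. Set $\eta_j=h_j-H(x_j)$ for nodal values $U_j=[h_j,q_j]^T$ on a uniform mesh $\{x_j\}$ of step $\Delta x$. Water-at-rest stationary solutions are $h^*(x)=\eta^*+H(x)$, $q^*=0$, with $\eta^*$ constant. At node $i$ the method selects the one with $h^*(x_i)=h_i$, i.e. $U_i^*(x)=[\eta_i+H(x),\,0]^T$. Reconstructions. $\mathcal R^L,\mathcal R^R$ are the left- and right-biased WENO reconstruction operators of order $2k+1$, taking $2k+1$ vectors of $\mathbb R^2$ to a vector of $\mathbb R^2$. They are computed component by component and satisfy $\mathcal R^{L,R}(\mathcal G_1-V,\dots,\mathcal G_{2k+1}-V)=\mathcal R^{L,R}(\mathcal G_1,\dots,\mathcal G_{2k+1})-V$ for all vectors $\mathcal G_m,V$. Global Lax–Friedrichs splitting. $F^\pm(U)=\tfrac12(F(U)\pm\alpha U)$, where $\alpha$ is one constant, the same for all $i$ (the maximum over the mesh of the absolute values of the eigenvalues of the Jacobian of $F$ at the $U_j$). Numerical fluxes. For each $i$ the fluxes are built from the differences $F^\pm(U_j)-F^\pm(U_i^*(x_j))=\tfrac12\mathcal G^{\pm}_{j}$, where $\mathcal G^\pm_j=F(U_j)-F(U_i^*(x_j))\pm\alpha(U_j-U_i^*(x_j))$ (depending on $i$). The reconstruction operators are applied to the values $\mathcal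 G^\pm_j$ and the factor $\tfrac12$ is applied to the result: $$\widehat{\mathcal F}_{i,i+1/2}=\tfrac12\left(\mathcal R^L(\mathcal G^+_{i-k},\dots,\mathcal G^+_{i+k})+\mathcal R^R(\mathcal G^-_{i-k+1},\dots,\mathcal G^-_{i+k+1})\right),$$ $$\widehat{\mathcal F}_{i,i-1/2}=\tfrac12\left(\mathcal R^L(\mathcal G^+_{i-k-1},\dots,\mathcal G^+_{i+k-1})+\mathcal R^R(\mathcal G^-_{i-k},\dots,\mathcal G^-_{i+k})\right).$$ The method is $$\frac{dU_i}{dt}+\frac1{\Delta x}\left(\widehat{\mathcal F}_{i,i+1/2}-\widehat{\mathcal F}_{i,i-1/2}\right)=0 .$$ *)

theory Defs
  imports "HOL-Analysis.Analysis" "HOL-Computational_Algebra.Polynomial"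
begin

section \<open>Shallow water system\<close>

definition sw_flux :: "real \<Rightarrow> real^2 \<Rightarrow> real^2" where
  "sw_flux g U = vector [U$2, (U$2)\<^sup>2 / U$1 + g / 2 * (U$1)\<^sup>2]"

definition sw_source :: "real \<Rightarrow> real^2 \<Rightarrow> real^2" where
  "sw_source g U = vector [0, g * U$1]"

definition water_at_rest :: "(real \<Rightarrow> real) \<Rightarrow> real \<Rightarrow> real \<Rightarrow> real^2" where
  "water_at_rest H \<eta> x = vector [\<eta> + H x, 0]"

lemma water_at_rest_stationary:
  assumes "(H has_real_derivative H') (at x)"
  shows "((\<lambda>x. sw_flux g (water_at_rest H \<eta> x)) has_vector_derivative
           H' *\<^sub>R sw_source g (water_at_rest H \<eta> x)) (at x)"
proof -
  have "((\<lambda>x. g / 2 * (\<eta> + H x)\<^sup>2) has_real_derivative H' * (g * (\<eta> + H x))) (at x)"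
    by (auto intro!: derivative_eq_intros assms simp: power2_eq_square)
  from has_vector_derivative_scaleR[OF this has_vector_derivative_const[of "vector [0, 1] :: real^2"]]
  have "((\<lambda>x. (g / 2 * (\<eta> + H x)\<^sup>2) *\<^sub>R (vector [0, 1] :: real^2)) has_vector_derivative
           (H' * (g * (\<eta> + H x))) *\<^sub>R (vector [0, 1] :: real^2)) (at x)"
    by simp
  moreover have "sw_flux g (water_at_rest H \<eta> y) = (g / 2 * (\<eta> + H y)\<^sup>2) *\<^sub>R vector [0, 1]" for y
    by (simp add: sw_flux_def water_at_rest_def vec_eq_iff forall_2)
  moreover have "H' *\<^sub>R sw_source g (water_at_rest H \<eta> x)
      = (H' * (g * (\<eta> + H x))) *\<^sub>R vector [0, 1]"
    by (simp add: sw_source_def water_at_rest_def vec_eq_iff forall_2)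
  ultimately show ?thesis
    by simp
qed

section \<open>Reconstruction operators\<close>

text \<open>
  An operator taking \<open>n\<close> vectors to a vector, computed component by component
  (component \<open>c\<close> of the result is obtained by applying the scalar operator \<open>\<rho> c\<close> to the
  components \<open>c\<close> of the arguments) and commuting with the subtraction of a constant vector.
  WENO operators enter only through these properties, so that every variant of the
  nonlinear weights is covered; the classical Jiang--Shu operators of order \<open>2k+1\<close> are
  shown to be an instance below.
\<close>

definition reconstruction_operator ::
  "nat \<Rightarrow> ((real^2) list \<Rightarrow> real^2) \<Rightarrow> (2 \<Rightarrow> real list \<Rightarrow> real) \<Rightarrow> bool" where
  "reconstruction_operator n R \<rho> \<longleftrightarrow>
     (\<forall>G. length G = n \<longrightarrow> (\<forall>c. R G $ c = \<rho> c (map (\<lambda>v. v $ c) G))) \<and>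
     (\<forall>G V. length G = n \<longrightarrow> R (map (\<lambda>v. v - V) G) = R G - V)"

subsection \<open>The classical WENO operators\<close>

text \<open>
  The entries of a list \<open>v\<close> of length \<open>2k+1\<close> are averages over consecutive unit cells.
  In the candidate stencil \<open>r \<le> k\<close>, consisting of the cells \<open>r, \<dots>, r+k\<close>, the coordinate is
  chosen so that cell \<open>r+j\<close> is the interval from \<open>j\<close> to \<open>j+1\<close>; the central cell \<open>k\<close> is
  then the interval from \<open>k-r\<close> to \<open>k-r+1\<close>.  The candidate polynomial, which has the given
  cell averages, is the derivative of the interpolant of the primitive.
\<close>

definition lagrange_basis :: "nat \<Rightarrow> nat \<Rightarrow> real poly" where
  "lagrange_basis n m = (\<Prod>l\<in>{..n} - {m}. smult (1 / (real m - real l)) [:- real l, 1:])"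

definition weno_candidate :: "nat \<Rightarrow> real list \<Rightarrow> nat \<Rightarrow> real poly" where
  "weno_candidate k v r =
     pderiv (\<Sum>m\<le>k + 1. smult (\<Sum>j<m. v ! (r + j)) (lagrange_basis (k + 1) m))"

definition weno_smoothness :: "nat \<Rightarrow> real list \<Rightarrow> nat \<Rightarrow> real" where
  "weno_smoothness k v r =
     (\<Sum>l=1..k. integral {real k - real r..real k - real r + 1}
                 (\<lambda>y. (poly ((pderiv ^^ l) (weno_candidate k v r)) y)\<^sup>2))"

text \<open>
  The binomial quotient is the optimal linear weight: with it the candidates combine to
  the reconstruction of order \<open>2k+1\<close> (\<open>1/3, 2/3\<close> for \<open>k = 1\<close> and \<open>1/10, 6/10, 3/10\<close> for
  \<open>k = 2\<close>).
\<close>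

definition weno_weight :: "nat \<Rightarrow> real \<Rightarrow> nat \<Rightarrow> real list \<Rightarrow> nat \<Rightarrow> real" where
  "weno_weight k \<epsilon> p v r =
     real ((k + 1 choose r) * (k choose r)) / real (2 * k + 1 choose k)
       / (\<epsilon> + weno_smoothness k v r) ^ p"

definition weno_left :: "nat \<Rightarrow> real \<Rightarrow> nat \<Rightarrow> real list \<Rightarrow> real" where
  "weno_left k \<epsilon> p v =
     (\<Sum>r\<le>k. weno_weight k \<epsilon> p v r * poly (weno_candidate k v r) (real k - real r + 1))
       / (\<Sum>r\<le>k. weno_weight k \<epsilon> p v r)"

definition weno_right :: "nat \<Rightarrow> real \<Rightarrow> nat \<Rightarrow> real list \<Rightarrow> real" where
  "weno_right k \<epsilon> p v = weno_left k \<epsilon> p (rev v)"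

lemma poly_lagrange_basis:
  assumes "m \<le> n" "i \<le> n"
  shows "poly (lagrange_basis n m) (real i) = (if i = m then 1 else 0)"
proof (cases "i = m")
  case True
  then show ?thesis
    unfolding lagrange_basis_def poly_prod
    by (auto intro!: prod.neutral simp flip: diff_divide_distrib)
next
  case False
  then show ?thesis
    using assms unfolding lagrange_basis_def poly_prod
    by (auto intro!: prod_zero bexI[of _ i])
qed

lemma degree_lagrange_basis:
  assumes "m \<le> n"
  shows "degree (lagrange_basis n m) \<le> n"
proof -
  have "degree (lagrange_basis n m)
          \<le> (\<Sum>l\<in>{..n} - {m}. degree (smult (1 / (real m - real l)) [:- real l, 1:]))"
    using degree_prod_sum_le[of "{..n} - {m}" "\<lambda>l. smult (1 / (real m - real l)) [:- real l, 1:]"]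
    by (simp add: lagrange_basis_def comp_def del: degree_smult_eq)
  also have "\<dots> \<le> (\<Sum>l\<in>{..n} - {m}. 1)"
    by (intro sum_mono) auto
  also have "\<dots> = n"
    using assms by simp
  finally show ?thesis .
qed

lemma smult_sum_right: "smult b (\<Sum>m\<in>A. f m) = (\<Sum>m\<in>A. smult b (f m))" for b :: real
  by (induction A rule: infinite_finite_induct) (auto simp: smult_add_right)

lemma sum_lagrange_basis_linear:
  assumes "n \<ge> 1"
  shows "(\<Sum>m\<le>n. smult (real m) (lagrange_basis n m)) = [:0, 1:]"
proof (rule ccontr)
  define P where "P = (\<Sum>m\<le>n. smult (real m) (lagrange_basis n m)) - [:0, 1:]"
  assume "(\<Sum>m\<le>n. smult (real m) (lagrange_basis n m)) \<noteq> [:0, 1:]"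
  then have "P \<noteq> 0"
    by (simp add: P_def)
  have "degree P \<le> n"
    unfolding P_def using assms
    by (intro degree_diff_le degree_sum_le) (auto intro: order.trans[OF degree_smult_le] degree_lagrange_basis)
  have "poly P (real i) = 0" if "i \<le> n" for i
  proof -
    have "(\<Sum>m\<le>n. real m * poly (lagrange_basis n m) (real i)) = (\<Sum>m\<le>n. if i = m then real m else 0)"
      by (rule sum.cong) (use that in \<open>auto simp: poly_lagrange_basis\<close>)
    then show ?thesis
      using that by (simp add: P_def poly_sum)
  qed
  then have "real ` {..n} \<subseteq> {x. poly P x = 0}"
    by auto
  then have "card (real ` {..n}) \<le> degree P"
    using card_mono[OF poly_roots_finite[OF \<open>P \<noteq> 0\<close>]] card_poly_roots_bound[OF \<open>P \<noteq> 0\<close>]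
    by (meson order.trans)
  then show False
    using \<open>degree P \<le> n\<close> by (simp add: card_image)
qed

lemma weno_candidate_translate:
  assumes "length v = 2 * k + 1" "r \<le> k"
  shows "weno_candidate k (map (\<lambda>a. a - b) v) r = weno_candidate k v r - [:b:]"
proof -
  have "(\<Sum>m\<le>k + 1. smult (\<Sum>j<m. map (\<lambda>a. a - b) v ! (r + j)) (lagrange_basis (k + 1) m))
      = (\<Sum>m\<le>k + 1. smult (\<Sum>j<m. v ! (r + j)) (lagrange_basis (k + 1) m)
           - smult b (smult (real m) (lagrange_basis (k + 1) m)))"
  proof (rule sum.cong)
    fix m assume "m \<in> {..k + 1}"
    then have "(\<Sum>j<m. map (\<lambda>a. a - b) v ! (r + j)) = (\<Sum>j<m. v ! (r + j) - b)"
      using assms by (intro sum.cong) auto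
    then show "smult (\<Sum>j<m. map (\<lambda>a. a - b) v ! (r + j)) (lagrange_basis (k + 1) m)
      = smult (\<Sum>j<m. v ! (r + j)) (lagrange_basis (k + 1) m)
           - smult b (smult (real m) (lagrange_basis (k + 1) m))"
      by (simp add: sum_subtractf smult_diff_left mult.commute)
  qed simp
  also have "\<dots> = (\<Sum>m\<le>k + 1. smult (\<Sum>j<m. v ! (r + j)) (lagrange_basis (k + 1) m))
      - smult b (\<Sum>m\<le>k + 1. smult (real m) (lagrange_basis (k + 1) m))"
    by (simp only: sum_subtractf smult_sum_right)
  also have "\<dots> = (\<Sum>m\<le>k + 1. smult (\<Sum>j<m. v ! (r + j)) (lagrange_basis (k + 1) m)) - smult b [:0, 1:]"
    by (subst sum_lagrange_basis_linear) auto
  finally show ?thesis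
    unfolding weno_candidate_def by (simp add: pderiv_diff pderiv_pCons)
qed

lemma weno_smoothness_translate:
  assumes "length v = 2 * k + 1" "r \<le> k"
  shows "weno_smoothness k (map (\<lambda>a. a - b) v) r = weno_smoothness k v r"
proof -
  have "(pderiv ^^ l) (weno_candidate k v r - [:b:]) = (pderiv ^^ l) (weno_candidate k v r)"
    if "l \<ge> 1" for l
    using that by (induction l rule: dec_induct) (auto simp: pderiv_diff pderiv_pCons)
  then show ?thesis
    unfolding weno_smoothness_def weno_candidate_translate[OF assms] by (intro sum.cong) auto
qed

lemma weno_weight_pos:
  assumes "\<epsilon> > 0" "r \<le> k"
  shows "weno_weight k \<epsilon> p v r > 0"
proof -
  have "weno_smoothness k v r \<ge> 0"
    unfolding weno_smoothness_def
    by (intro sum_nonneg integral_nonneg integrable_continuous_interval continuous_intros) auto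
  then show ?thesis
    using assms by (auto simp: weno_weight_def intro!: divide_pos_pos mult_pos_pos zero_less_power)
qed

lemma weno_left_translate:
  assumes "\<epsilon> > 0" "length v = 2 * k + 1"
  shows "weno_left k \<epsilon> p (map (\<lambda>a. a - b) v) = weno_left k \<epsilon> p v - b"
proof -
  define w where "w = weno_weight k \<epsilon> p v"
  have w: "weno_weight k \<epsilon> p (map (\<lambda>a. a - b) v) r = w r" if "r \<le> k" for r
    using assms that by (simp add: w_def weno_weight_def weno_smoothness_translate)
  have "(\<Sum>r\<le>k. w r) > 0"
    using assms by (intro sum_pos) (auto simp: w_def weno_weight_pos)
  moreover have "weno_left k \<epsilon> p (map (\<lambda>a. a - b) v) =
      (\<Sum>r\<le>k. w r * (poly (weno_candidate k v r) (real k - real r + 1) - b)) / (\<Sum>r\<le>k. w r)"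
    unfolding weno_left_def using assms
    by (intro arg_cong2[where f = "(/)"] sum.cong) (auto simp: w weno_candidate_translate)
  ultimately show ?thesis
    by (simp add: weno_left_def w_def right_diff_distrib sum_subtractf diff_divide_distrib
        flip: sum_distrib_right)
qed

lemma weno_reconstruction_operators:
  assumes "\<epsilon> > 0"
  shows "reconstruction_operator (2 * k + 1)
           (\<lambda>G. \<chi> c. weno_left k \<epsilon> p (map (\<lambda>v. v $ c) G)) (\<lambda>c. weno_left k \<epsilon> p)"
    and "reconstruction_operator (2 * k + 1)
           (\<lambda>G. \<chi> c. weno_right k \<epsilon> p (map (\<lambda>v. v $ c) G)) (\<lambda>c. weno_right k \<epsilon> p)"
proof -
  have m: "map (\<lambda>v. v $ c) (map (\<lambda>v. v - V) G) = map (\<lambda>a. a - V $ c) (map (\<lambda>v. v $ c) G)"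
    for c :: 2 and G :: "(real^2) list" and V
    by simp
  show "reconstruction_operator (2 * k + 1)
           (\<lambda>G. \<chi> c. weno_left k \<epsilon> p (map (\<lambda>v. v $ c) G)) (\<lambda>c. weno_left k \<epsilon> p)"
    using assms unfolding reconstruction_operator_def m by (simp add: vec_eq_iff weno_left_translate del: map_map)
  show "reconstruction_operator (2 * k + 1)
           (\<lambda>G. \<chi> c. weno_right k \<epsilon> p (map (\<lambda>v. v $ c) G)) (\<lambda>c. weno_right k \<epsilon> p)"
    using assms unfolding reconstruction_operator_def m weno_right_def rev_map[of "\<lambda>a. a - _"]
    by (simp add: vec_eq_iff weno_left_translate del: map_map)
qed

section \<open>Numerical method\<close>

definition is_eigenvalue :: "real^'n^'n \<Rightarrow> real \<Rightarrow> bool" where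
  "is_eigenvalue A \<mu> \<longleftrightarrow> (\<exists>v. v \<noteq> 0 \<and> A *v v = \<mu> *\<^sub>R v)"

definition is_global_speed :: "real \<Rightarrow> (int \<Rightarrow> real^2) \<Rightarrow> real \<Rightarrow> bool" where
  "is_global_speed g U \<alpha> \<longleftrightarrow>
     (let S = {\<bar>\<mu>\<bar> | \<mu> j. is_eigenvalue (jacobian (sw_flux g) (at (U j))) \<mu>}
      in \<alpha> \<in> S \<and> (\<forall>s\<in>S. s \<le> \<alpha>))"

text \<open>The signs \<open>+\<close> and \<open>-\<close> of the splitting are encoded by \<open>\<sigma> = 1\<close> and \<open>\<sigma> = -1\<close>.\<close>

definition lf_split :: "real \<Rightarrow> real \<Rightarrow> real \<Rightarrow> real^2 \<Rightarrow> real^2" where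
  "lf_split \<sigma> g \<alpha> U = (1/2) *\<^sub>R (sw_flux g U + (\<sigma> * \<alpha>) *\<^sub>R U)"

definition flux_diff ::
  "real \<Rightarrow> real \<Rightarrow> real \<Rightarrow> (int \<Rightarrow> real) \<Rightarrow> (int \<Rightarrow> real^2) \<Rightarrow> (real \<Rightarrow> real^2) \<Rightarrow> int \<Rightarrow> real^2" where
  "flux_diff \<sigma> g \<alpha> x U Us j =
     sw_flux g (U j) - sw_flux g (Us (x j)) + (\<sigma> * \<alpha>) *\<^sub>R (U j - Us (x j))"

lemma lf_split_diff:
  "lf_split \<sigma> g \<alpha> (U j) - lf_split \<sigma> g \<alpha> (Us (x j)) = (1/2) *\<^sub>R flux_diff \<sigma> g \<alpha> x U Us j"
  by (simp add: lf_split_def flux_diff_def algebra_simps)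

text \<open>
  The numerical flux at the interface \<open>m + 1/2\<close> built with the stationary solution \<open>Us\<close>.
  With the one selected at node \<open>i\<close>, the cases \<open>m = i\<close> and \<open>m = i - 1\<close> are the two
  fluxes of the method at that node.
\<close>

definition interface_flux ::
  "((real^2) list \<Rightarrow> real^2) \<Rightarrow> ((real^2) list \<Rightarrow> real^2) \<Rightarrow> nat \<Rightarrow> real \<Rightarrow> real \<Rightarrow>
   (int \<Rightarrow> real) \<Rightarrow> (int \<Rightarrow> real^2) \<Rightarrow> (real \<Rightarrow> real^2) \<Rightarrow> int \<Rightarrow> real^2" where
  "interface_flux RL RR k g \<alpha> x U Us m = (1/2) *\<^sub>R
     (RL (map (flux_diff 1 g \<alpha> x U Us) [m - int k..m + int k]) +
      RR (map (flux_diff (-1) g \<alpha> x U Us) [m - int k + 1..m + int k + 1]))"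

definition surface :: "(real \<Rightarrow> real) \<Rightarrow> (int \<Rightarrow> real) \<Rightarrow> (int \<Rightarrow> real^2) \<Rightarrow> int \<Rightarrow> real" where
  "surface H x U j = U j $ 1 - H (x j)"

definition selected_stationary ::
  "(real \<Rightarrow> real) \<Rightarrow> (int \<Rightarrow> real) \<Rightarrow> (int \<Rightarrow> real^2) \<Rightarrow> int \<Rightarrow> real \<Rightarrow> real^2" where
  "selected_stationary H x U i = water_at_rest H (surface H x U i)"

definition flux_right ::
  "((real^2) list \<Rightarrow> real^2) \<Rightarrow> ((real^2) list \<Rightarrow> real^2) \<Rightarrow> nat \<Rightarrow> real \<Rightarrow> real \<Rightarrow>
   (real \<Rightarrow> real) \<Rightarrow> (int \<Rightarrow> real) \<Rightarrow> (int \<Rightarrow> real^2) \<Rightarrow> int \<Rightarrow> real^2" where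
  "flux_right RL RR k g \<alpha> H x U i =
     interface_flux RL RR k g \<alpha> x U (selected_stationary H x U i) i"

definition flux_left ::
  "((real^2) list \<Rightarrow> real^2) \<Rightarrow> ((real^2) list \<Rightarrow> real^2) \<Rightarrow> nat \<Rightarrow> real \<Rightarrow> real \<Rightarrow>
   (real \<Rightarrow> real) \<Rightarrow> (int \<Rightarrow> real) \<Rightarrow> (int \<Rightarrow> real^2) \<Rightarrow> int \<Rightarrow> real^2" where
  "flux_left RL RR k g \<alpha> H x U i =
     interface_flux RL RR k g \<alpha> x U (selected_stationary H x U i) (i - 1)"

definition semidiscrete_solution ::
  "((real^2) list \<Rightarrow> real^2) \<Rightarrow> ((real^2) list \<Rightarrow> real^2) \<Rightarrow> nat \<Rightarrow> real \<Rightarrow> (real \<Rightarrow> real) \<Rightarrow>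
   (int \<Rightarrow> real) \<Rightarrow> real \<Rightarrow> real set \<Rightarrow> (real \<Rightarrow> real) \<Rightarrow> (real \<Rightarrow> int \<Rightarrow> real^2) \<Rightarrow> bool" where
  "semidiscrete_solution RL RR k g H x \<Delta>x T \<alpha> U \<longleftrightarrow>
     (\<forall>t\<in>T. (\<forall>j. U t j $ 1 > 0) \<and> is_global_speed g (U t) (\<alpha> t) \<and>
       (\<forall>i. ((\<lambda>s. U s i) has_vector_derivative
          - ((1 / \<Delta>x) *\<^sub>R (flux_right RL RR k g (\<alpha> t) H x (U t) i
                        - flux_left RL RR k g (\<alpha> t) H x (U t) i)))
          (at t within T)))"

definition fhat_minus ::
  "(real list \<Rightarrow> real) \<Rightarrow> nat \<Rightarrow> real \<Rightarrow> (real \<Rightarrow> real) \<Rightarrow> (int \<Rightarrow> real) \<Rightarrow> (int \<Rightarrow> real^2) \<Rightarrow> int \<Rightarrow> real" where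
  "fhat_minus RR1 k \<alpha> H x U i =
     RR1 (map (\<lambda>j. U j $ 2 - \<alpha> * surface H x U j) [i - int k + 1..i + int k + 1])"

definition fhat_plus ::
  "(real list \<Rightarrow> real) \<Rightarrow> nat \<Rightarrow> real \<Rightarrow> (real \<Rightarrow> real) \<Rightarrow> (int \<Rightarrow> real) \<Rightarrow> (int \<Rightarrow> real^2) \<Rightarrow> int \<Rightarrow> real" where
  "fhat_plus RL1 k \<alpha> H x U i =
     RL1 (map (\<lambda>j. U j $ 2 + \<alpha> * surface H x U j) [i - int k..i + int k])"

definition mass_flux ::
  "(real list \<Rightarrow> real) \<Rightarrow> (real list \<Rightarrow> real) \<Rightarrow> nat \<Rightarrow> real \<Rightarrow> (real \<Rightarrow> real) \<Rightarrow> (int \<Rightarrow> real) \<Rightarrow>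
   (int \<Rightarrow> real^2) \<Rightarrow> int \<Rightarrow> real" where
  "mass_flux RL1 RR1 k \<alpha> H x U i =
     (1/2) * (fhat_minus RR1 k \<alpha> H x U i + fhat_plus RL1 k \<alpha> H x U i)"

end

(* The first component of the splitting differences is q_j + \<sigma> \<alpha> \<eta>_j - \<sigma> \<alpha> \<eta>, with \<eta> the level of
   the selected stationary solution.  The reconstructions commute with constants, so that \<eta> enters
   the two halves of the flux as -\<alpha> \<eta> and +\<alpha> \<eta> and cancels.  The mass flux at an interface is
   therefore the same for the two adjacent nodes, and sums over cells telescope. *)

theory Submission
  imports Defs
begin

lemma reconstruction_operator_component:
  assumes "reconstruction_operator n R \<rho>" "length G = n"
  shows "R G $ c = \<rho> c (map (\<lambda>v. v $ c) G)"
  using assms by (simp add: reconstruction_operator_def)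

text \<open>The translation law is given for vectors. Every scalar list is a component of a list of
  constant vectors \<open>vec a\<close>, so the law descends to each scalar operator
  \<open>\<rho> c\<close>.\<close>

lemma reconstruction_operator_scalar_translate:
  assumes "reconstruction_operator n R \<rho>" "length v = n"
  shows "\<rho> c (map (\<lambda>a. a - b) v) = \<rho> c v - b"
proof -
  define G :: "(real^2) list" where "G = map vec v"
  have G: "length G = n" "map (\<lambda>v. v $ c) G = v"
    by (simp_all add: G_def assms comp_def)
  have "R (map (\<lambda>v. v - vec b) G) $ c = \<rho> c (map (\<lambda>a. a - b) v)"
    using reconstruction_operator_component[OF assms(1), of "map (\<lambda>v. v - vec b) G" c]
    by (simp add: G_def assms(2) comp_def)
  moreover have "R (map (\<lambda>v. v - vec b) G) = R G - vec b"
    using assms(1) G(1) by (simp add: reconstruction_operator_def)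
  moreover have "R G $ c = \<rho> c v"
    using reconstruction_operator_component[OF assms(1) G(1)] G(2) by simp
  ultimately show ?thesis
    by simp
qed

text \<open>The mass component of \<open>sw_flux\<close> is the discharge, which vanishes at rest,
  and subtracting \<open>\<eta> + H (x j)\<close> from the depth leaves the surface minus
  \<open>\<eta>\<close>. The level thus enters as a term constant in \<open>j\<close>.\<close>

lemma flux_diff_water_at_rest_mass:
  "flux_diff \<sigma> g \<alpha> x U (water_at_rest H \<eta>) j $ 1
     = (U j $ 2 + \<sigma> * \<alpha> * surface H x U j) - \<sigma> * \<alpha> * \<eta>"
  by (simp add: flux_diff_def sw_flux_def water_at_rest_def surface_def algebra_simps)

lemma reconstructed_flux_diff_mass:
  assumes "reconstruction_operator n R \<rho>" "length js = n"
  shows "R (map (flux_diff \<sigma> g \<alpha> x U (water_at_rest H \<eta>)) js) $ 1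
           = \<rho> 1 (map (\<lambda>j. U j $ 2 + \<sigma> * \<alpha> * surface H x U j) js) - \<sigma> * \<alpha> * \<eta>"
  using reconstruction_operator_component[OF assms(1),
      of "map (flux_diff \<sigma> g \<alpha> x U (water_at_rest H \<eta>)) js" 1]
    reconstruction_operator_scalar_translate[OF assms(1),
      of "map (\<lambda>j. U j $ 2 + \<sigma> * \<alpha> * surface H x U j) js" 1 "\<sigma> * \<alpha> * \<eta>"]
  by (simp add: assms(2) comp_def flux_diff_water_at_rest_mass)

lemma interface_flux_water_at_rest_mass:
  assumes "reconstruction_operator (2 * k + 1) RL \<rho>L"
    and "reconstruction_operator (2 * k + 1) RR \<rho>R"
  shows "interface_flux RL RR k g \<alpha> x U (water_at_rest H \<eta>) m $ 1
           = mass_flux (\<rho>L 1) (\<rho>R 1) k \<alpha> H x U m"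
  \<comment> \<open>Both stencils have \<open>2 * k + 1\<close> nodes, as the operators require. The
    signs 1 and -1 pull out the opposite constants \<open>\<alpha> * \<eta>\<close> and
    \<open>- \<alpha> * \<eta>\<close>.\<close>
  using reconstructed_flux_diff_mass[OF assms(1), of "[m - int k..m + int k]" 1]
    reconstructed_flux_diff_mass[OF assms(2), of "[m - int k + 1..m + int k + 1]" "-1"]
  by (simp add: interface_flux_def mass_flux_def fhat_plus_def fhat_minus_def)

lemma map_upto_shift: "map f [a + N..b + N] = map (\<lambda>j. f (j + N)) [a..b]"
  by (rule nth_equalityI) (auto simp: algebra_simps)

text \<open>The nodes enter only through the depths \<open>H (x j)\<close>, so periodicity is asked
  of these values and not of the mesh points, which move on by a period.\<close>

lemma mass_flux_periodic:
  assumes "\<And>j. H (x (j + N)) = H (x j)" "\<And>j. U (j + N) = U j"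
  shows "mass_flux RL1 RR1 k \<alpha> H x U (i + N) = mass_flux RL1 RR1 k \<alpha> H x U i"
proof -
  \<comment> \<open>Rewriting the stencils at \<open>i + N\<close> as shifts by \<open>N\<close> of
    those at \<open>i\<close> exposes terms of the form \<open>f (j + N)\<close>, to which the
    periodicity assumptions apply.\<close>
  have "map f [i + N - int k..i + N + int k] = map (\<lambda>j. f (j + N)) [i - int k..i + int k]"
    "map f [i + N - int k + 1..i + N + int k + 1]
       = map (\<lambda>j. f (j + N)) [i - int k + 1..i + int k + 1]" for f :: "int \<Rightarrow> real"
    using map_upto_shift[of f "i - int k" N "i + int k"]
      map_upto_shift[of f "i - int k + 1" N "i + int k + 1"]
    by (simp_all add: algebra_simps)
  then show ?thesis
    by (simp only: mass_flux_def fhat_minus_def fhat_plus_def surface_def assms)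
qed

lemma sum_telescope_int:
  fixes F :: "int \<Rightarrow> 'a::ab_group_add"
  assumes "a \<le> b"
  shows "(\<Sum>i=a..b. F i - F (i - 1)) = F b - F (a - 1)"
  using assms
proof (induction b rule: int_ge_induct)
  case (step b)
  then have "{a..b + 1} = insert (b + 1) {a..b}"
    by auto
  with step show ?case
    by simp
qed simp

text \<open>Taking a component is bounded linear and so commutes with the time derivative. The two
  fluxes at node \<open>i\<close> belong to the interfaces \<open>i\<close> and
  \<open>i - 1\<close>, and their mass components are values of one function of the
  interface.\<close>

lemma semidiscrete_solution_mass_derivative:
  assumes "reconstruction_operator (2 * k + 1) RL \<rho>L"
    and "reconstruction_operator (2 * k + 1) RR \<rho>R"
    and "semidiscrete_solution RL RR k g H x \<Delta>x T \<alpha> U" "t \<in> T"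
  shows "((\<lambda>s. U s i $ 1) has_real_derivative
            - (1 / \<Delta>x) * (mass_flux (\<rho>L 1) (\<rho>R 1) k (\<alpha> t) H x (U t) i
                          - mass_flux (\<rho>L 1) (\<rho>R 1) k (\<alpha> t) H x (U t) (i - 1))) (at t within T)"
proof -
  have "((\<lambda>s. U s i) has_vector_derivative
          - ((1 / \<Delta>x) *\<^sub>R (flux_right RL RR k g (\<alpha> t) H x (U t) i
                        - flux_left RL RR k g (\<alpha> t) H x (U t) i))) (at t within T)"
    using assms(3,4) by (simp add: semidiscrete_solution_def)
  from bounded_linear.has_vector_derivative[OF bounded_linear_vec_nth this, of 1]
  show ?thesis
    by (simp add: has_real_derivative_iff_has_vector_derivative flux_right_def flux_left_def
        selected_stationary_def interface_flux_water_at_rest_mass[OF assms(1,2)])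
qed

text \<open>An index of \<open>mass_flux\<close> denotes the interface to the right of that cell, so
  \<open>a - 1\<close> and \<open>b\<close> are the two ends of the block. The interior interfaces
  cancel by telescoping.\<close>

lemma semidiscrete_solution_total_mass_derivative:
  assumes "reconstruction_operator (2 * k + 1) RL \<rho>L"
    and "reconstruction_operator (2 * k + 1) RR \<rho>R"
    and "semidiscrete_solution RL RR k g H x \<Delta>x T \<alpha> U" "t \<in> T"
    and "\<Delta>x \<noteq> 0" "a \<le> b"
  shows "((\<lambda>s. \<Sum>i=a..b. \<Delta>x * U s i $ 1) has_real_derivative
            mass_flux (\<rho>L 1) (\<rho>R 1) k (\<alpha> t) H x (U t) (a - 1)
            - mass_flux (\<rho>L 1) (\<rho>R 1) k (\<alpha> t) H x (U t) b) (at t within T)"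
proof -
  define F where "F = mass_flux (\<rho>L 1) (\<rho>R 1) k (\<alpha> t) H x (U t)"
  have "((\<lambda>s. \<Sum>i=a..b. \<Delta>x * U s i $ 1) has_real_derivative
          (\<Sum>i=a..b. \<Delta>x * (- (1 / \<Delta>x) * (F i - F (i - 1))))) (at t within T)"
    unfolding F_def
    by (intro DERIV_sum DERIV_cmult semidiscrete_solution_mass_derivative[OF assms(1-4)])
  also have "(\<Sum>i=a..b. \<Delta>x * (- (1 / \<Delta>x) * (F i - F (i - 1)))) = - (\<Sum>i=a..b. F i - F (i - 1))"
    using assms(5) by (simp flip: sum_negf)
  also have "\<dots> = F (a - 1) - F b"
    by (simp add: sum_telescope_int[OF assms(6)])
  finally show ?thesis
    by (simp add: F_def)
qed

text \<open>The ends of one period are the interfaces \<open>- 1\<close> and \<open>N - 1\<close>,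
  which carry equal fluxes, so the total mass has zero derivative. Constancy follows because an
  interval is convex.\<close>

lemma semidiscrete_solution_periodic_mass_conserved:
  assumes "reconstruction_operator (2 * k + 1) RL \<rho>L"
    and "reconstruction_operator (2 * k + 1) RR \<rho>R"
    and "semidiscrete_solution RL RR k g H x \<Delta>x T \<alpha> U" "is_interval T"
    and "\<Delta>x \<noteq> 0" "N > 0"
    and "\<And>j. H (x (j + N)) = H (x j)" "\<And>t j. t \<in> T \<Longrightarrow> U t (j + N) = U t j"
    and "s \<in> T" "t \<in> T"
  shows "(\<Sum>i=0..<N. \<Delta>x * U s i $ 1) = (\<Sum>i=0..<N. \<Delta>x * U t i $ 1)"
proof -
  have "((\<lambda>s. \<Sum>i=0..<N. \<Delta>x * U s i $ 1) has_real_derivative 0) (at t within T)" if "t \<in> T" for t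
  proof -
    have "mass_flux (\<rho>L 1) (\<rho>R 1) k (\<alpha> t) H x (U t) (- 1 + N)
            = mass_flux (\<rho>L 1) (\<rho>R 1) k (\<alpha> t) H x (U t) (- 1)"
      by (rule mass_flux_periodic) (simp_all add: assms(7,8) that)
    moreover have "{0..<N} = {0..N - 1}"
      by auto
    ultimately show ?thesis
      using semidiscrete_solution_total_mass_derivative[OF assms(1-3) that assms(5), of 0 "N - 1"]
        assms(6) by simp
  qed
  from has_field_derivative_zero_constant[OF is_interval_convex[OF assms(4)] this]
  show ?thesis
    using assms(9,10) by auto
qed

text \<open>Each interface receives a flux from both adjacent nodes, built with different stationary
  solutions; their agreement in the mass component is what makes the scheme conservative.
  Conservation is then expressed as a flux-difference form, a balance on blocks of cells and
  invariance of the mass over a period.\<close>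

theorem mainTheorem5:
  fixes RL RR :: "(real^2) list \<Rightarrow> real^2"
    and \<rho>L \<rho>R :: "2 \<Rightarrow> real list \<Rightarrow> real"
    and k :: nat and g \<Delta>x :: real and H :: "real \<Rightarrow> real" and x :: "int \<Rightarrow> real"
  assumes "g > 0" and "\<Delta>x > 0" and "\<forall>j. x j = x 0 + of_int j * \<Delta>x"
    and "reconstruction_operator (2 * k + 1) RL \<rho>L"
    and "reconstruction_operator (2 * k + 1) RR \<rho>R"
  shows
    "(\<forall>U \<alpha>. (\<forall>j. U j $ 1 > 0) \<and> is_global_speed g U \<alpha> \<longrightarrow>
        (\<forall>i. flux_right RL RR k g \<alpha> H x U i $ 1
               = 1/2 * (fhat_minus (\<rho>R 1) k \<alpha> H x U i + fhat_plus (\<rho>L 1) k \<alpha> H x U i)) \<and>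
        (\<forall>i \<eta>. interface_flux RL RR k g \<alpha> x U (water_at_rest H \<eta>) i $ 1
               = flux_right RL RR k g \<alpha> H x U i $ 1) \<and>
        (\<forall>i. flux_left RL RR k g \<alpha> H x U (i + 1) $ 1 = flux_right RL RR k g \<alpha> H x U i $ 1)) \<and>
     (\<forall>T \<alpha> U. is_interval T \<and> semidiscrete_solution RL RR k g H x \<Delta>x T \<alpha> U \<longrightarrow>
        (\<forall>t\<in>T. \<forall>i. ((\<lambda>s. U s i $ 1) has_real_derivative
             - (1 / \<Delta>x) * (mass_flux (\<rho>L 1) (\<rho>R 1) k (\<alpha> t) H x (U t) i
                           - mass_flux (\<rho>L 1) (\<rho>R 1) k (\<alpha> t) H x (U t) (i - 1))) (at t within T)) \<and>
        (\<forall>t\<in>T. \<forall>a b. a \<le> b \<longrightarrow>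
           ((\<lambda>s. \<Sum>i=a..b. \<Delta>x * U s i $ 1) has_real_derivative
             mass_flux (\<rho>L 1) (\<rho>R 1) k (\<alpha> t) H x (U t) (a - 1)
             - mass_flux (\<rho>L 1) (\<rho>R 1) k (\<alpha> t) H x (U t) b) (at t within T)) \<and>
        (\<forall>N>0. (\<forall>j. H (x (j + N)) = H (x j)) \<and> (\<forall>t\<in>T. \<forall>j. U t (j + N) = U t j) \<longrightarrow>
           (\<forall>s\<in>T. \<forall>t\<in>T. (\<Sum>i=0..<N. \<Delta>x * U s i $ 1) = (\<Sum>i=0..<N. \<Delta>x * U t i $ 1))))"
proof (intro conjI allI impI ballI; (elim conjE)?)
  note flux = interface_flux_water_at_rest_mass[OF assms(4,5)]
  fix U \<alpha> i \<eta>
  show "flux_right RL RR k g \<alpha> H x U i $ 1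
          = 1/2 * (fhat_minus (\<rho>R 1) k \<alpha> H x U i + fhat_plus (\<rho>L 1) k \<alpha> H x U i)"
    by (simp add: flux_right_def selected_stationary_def flux mass_flux_def)
  show "interface_flux RL RR k g \<alpha> x U (water_at_rest H \<eta>) i $ 1
          = flux_right RL RR k g \<alpha> H x U i $ 1"
    by (simp add: flux_right_def selected_stationary_def flux)
  \<comment> \<open>The left flux at \<open>i + 1\<close> lives at interface
    \<open>i + 1 - 1\<close>, the one of the right flux at \<open>i\<close>; only the selected
    levels differ.\<close>
  show "flux_left RL RR k g \<alpha> H x U (i + 1) $ 1 = flux_right RL RR k g \<alpha> H x U i $ 1"
    by (simp add: flux_left_def flux_right_def selected_stationary_def flux)
next
  fix T \<alpha> U t i
  assume "semidiscrete_solution RL RR k g H x \<Delta>x T \<alpha> U" "t \<in> T"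
  then show "((\<lambda>s. U s i $ 1) has_real_derivative
               - (1 / \<Delta>x) * (mass_flux (\<rho>L 1) (\<rho>R 1) k (\<alpha> t) H x (U t) i
                             - mass_flux (\<rho>L 1) (\<rho>R 1) k (\<alpha> t) H x (U t) (i - 1))) (at t within T)"
    by (rule semidiscrete_solution_mass_derivative[OF assms(4,5)])
next
  fix T \<alpha> U t and a b :: int
  assume "semidiscrete_solution RL RR k g H x \<Delta>x T \<alpha> U" "t \<in> T" "a \<le> b"
  then show "((\<lambda>s. \<Sum>i=a..b. \<Delta>x * U s i $ 1) has_real_derivative
               mass_flux (\<rho>L 1) (\<rho>R 1) k (\<alpha> t) H x (U t) (a - 1)
               - mass_flux (\<rho>L 1) (\<rho>R 1) k (\<alpha> t) H x (U t) b) (at t within T)"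
    using assms(2) by (intro semidiscrete_solution_total_mass_derivative[OF assms(4,5)]) auto
next
  fix T \<alpha> U s t and N :: int
  assume sol: "semidiscrete_solution RL RR k g H x \<Delta>x T \<alpha> U"
  assume "is_interval T" "N > 0" "s \<in> T" "t \<in> T"
    "\<forall>j. H (x (j + N)) = H (x j)" "\<forall>t\<in>T. \<forall>j. U t (j + N) = U t j"
  then show "(\<Sum>i=0..<N. \<Delta>x * U s i $ 1) = (\<Sum>i=0..<N. \<Delta>x * U t i $ 1)"
    using assms(2) by (intro semidiscrete_solution_periodic_mass_conserved[OF assms(4,5) sol]) auto
qed

end
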